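(* Let $\tilde\Gamma$ be an extended Dynkin diagram that is a tree, of class $g\in\{0,1,2,3\}$, and let ${\bf C}_a$ be the affine Coxeter transformation of $\tilde\Gamma$. Then ${\bf C}_a$ has the same eigenvalues as the product of the Coxeter transformations of types $A_i$ corresponding to $(3-g)$ branches of the corresponding Dynkin diagram $\Gamma$, together with two remaining eigenvalues which are both equal to $1$. In other words, with $\chi_n(\lambda)=\lambda^n+\lambda^{n-1}+\dots+\lambda+1$ and up to sign, the characteristic polynomial of ${\bf C}_a$ is $$ \begin{cases} (\lambda-1)^2\,\chi_{p-1}\chi_{q-1}\chi_{r-1} & \text{for } g=0,\\ (\lambda-1)^2\,\chi_{p-1}\chi_{q-1} & \text{for } g=1,\\ (\lambda-1)^2\,\chi_{p-1} & \text{for } g=2,\\ (\lambda-1)^2 & \text{for } g=3, \end{cases} $$ where the branch lengths $p,q,r$ are as listed in the context.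
   Context: For a valued tree with generalized Cartan matrix $K=(k_{ij})$ the simple reflections are $\sigma_i(z)=z-(Kz)_i\alpha_i$, and a Coxeter transformation is the product of all simple reflections, each taken once, in some order. For a tree all these products are conjugate, so the characteristic polynomial does not depend on the order. For an extended Dynkin diagram it is called the affine Coxeter transformation. The polynomial $\chi_n$ is, up to sign, the characteristic polynomial of the Coxeter transformation of $A_n$. Extended Dynkin diagrams (trees), identified by the affine types in Kac's notation: $\tilde D_n=D_n^{(1)}$ $(n\ge4)$, $\tilde E_6=E_6^{(1)}$, $\tilde E_7=E_7^{(1)}$, $\tilde E_8=E_8^{(1)}$, $\tilde F_{42}=F_4^{(1)}$, $\tilde F_{41}=E_6^{(2)}$, $\widetilde{CD}_n=B_n^{(1)}$, $\widetilde{DD}_n=A_{2n-1}^{(2)}$ $(n\ge3)$, $\tilde G_{22}=G_2^{(1)}$, $\tilde G_{21}=D_4^{(3)}$, $\tilde C_n=C_n^{(1)}$, $\tilde B_n=D_{n+1}^{(2)}$, $\widetilde{BC}_n=A_{2n}^{(2)}$ $(n\ge2)$, $\tilde A_{12}=A_1^{(1)}$, $\tilde A_{11}=A_2^{(2)}$. Classes and branch lengths. The branches are those of the Dynkin diagram $\Gamma$ with respect to its branch point; in the multiply-laced case the branch point is the vertex incident to one weighted and one unweighted edge. A branch of length $p$ contributes type $A_{p-1}$, i.e. the branch without the branch point. Class $g=0$: $\tilde E_6$ with $(p,q,r)=(2,3,3)$; $\tilde E_7$ with $(2,3,4)$; $\tilde E_8$ with $(2,3,5)$; $\tilde D_n$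 with $(2,2,n-2)$. Class $g=1$: $\tilde F_{41},\tilde F_{42}$ with $(p,q)=(2,3)$; $\widetilde{CD}_n,\widetilde{DD}_n$ with $(p,q)=(2,n-1)$. Class $g=2$: $\tilde G_{21},\tilde G_{22}$ with $p=2$; $\tilde B_n,\tilde C_n,\widetilde{BC}_n$ with $p=n$. Class $g=3$: $\tilde A_{11},\tilde A_{12}$. *)

theory Defs
  imports "Jordan_Normal_Form.Char_Poly" "HOL-Computational_Algebra.Polynomial"
begin

section \<open>Valued trees and generalized Cartan matrices\<close>

text \<open>
  A valued graph on the vertices \<open>0, \<dots>, n - 1\<close> is given by its list of edges
  \<open>(i, j, a, b)\<close>, standing for the Cartan matrix entries \<open>k\<^sub>i\<^sub>j = a\<close> and \<open>k\<^sub>j\<^sub>i = b\<close>.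
  In Kac's pictures the edge between \<open>i\<close> and \<open>j\<close> has an arrow pointing towards \<open>i\<close>
  iff \<open>\<bar>k\<^sub>i\<^sub>j\<bar> > 1\<close>.
\<close>

type_synonym valued_edge = "nat \<times> nat \<times> int \<times> int"

fun cartan_entry :: "valued_edge list \<Rightarrow> nat \<Rightarrow> nat \<Rightarrow> int" where
  "cartan_entry [] i j = (if i = j then 2 else 0)"
| "cartan_entry ((k, l, a, b) # es) i j =
     (if i = k \<and> j = l then a else if i = l \<and> j = k then b else cartan_entry es i j)"

definition cartan_mat :: "nat \<Rightarrow> valued_edge list \<Rightarrow> int mat" where
  "cartan_mat n es = mat n n (\<lambda>(i, j). cartan_entry es i j)"

abbreviation plain :: "nat \<Rightarrow> nat \<Rightarrow> valued_edge" where
  "plain i j \<equiv> (i, j, -1, -1)"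

text \<open>The unweighted edges of the chain \<open>i, i + 1, \<dots>, j\<close>.\<close>

definition chain :: "nat \<Rightarrow> nat \<Rightarrow> valued_edge list" where
  "chain i j = map (\<lambda>k. plain k (Suc k)) [i..<j]"

definition cartan_A :: "nat \<Rightarrow> int mat" where
  "cartan_A n = cartan_mat n (chain 0 (n - 1))"


section \<open>Coxeter transformations\<close>

text \<open>\<open>\<sigma>\<^sub>i(z) = z - (K z)\<^sub>i \<alpha>\<^sub>i\<close>, in coordinates with respect to the simple roots. The ground
  field is the complex numbers, so that all eigenvalues are available.\<close>

definition simple_reflection :: "int mat \<Rightarrow> nat \<Rightarrow> complex vec \<Rightarrow> complex vec" where
  "simple_reflection K i z =
     z - ((map_mat of_int K *\<^sub>v z) $ i) \<cdot>\<^sub>v unit_vec (dim_row K) i"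

text \<open>The matrix of \<open>\<sigma>\<^bsub>w 0\<^esub> \<circ> \<sigma>\<^bsub>w 1\<^esub> \<circ> \<dots>\<close>; its \<open>j\<close>-th column is the image of \<open>\<alpha>\<^sub>j\<close>.\<close>

definition reflection_product :: "int mat \<Rightarrow> nat list \<Rightarrow> complex mat" where
  "reflection_product K w =
     mat_of_cols (dim_row K)
       (map (\<lambda>j. foldr (simple_reflection K) w (unit_vec (dim_row K) j)) [0..<dim_row K])"

definition is_coxeter_transformation :: "int mat \<Rightarrow> complex mat \<Rightarrow> bool" where
  "is_coxeter_transformation K C \<longleftrightarrow>
     (\<exists>w. distinct w \<and> set w = {..<dim_row K} \<and> C = reflection_product K w)"

text \<open>The multiset of eigenvalues, counted with algebraic multiplicity.\<close>

definition eigenvalue_mset :: "complex mat \<Rightarrow> complex multiset" where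
  "eigenvalue_mset A = proots (char_poly A)"

definition chi :: "nat \<Rightarrow> complex poly" where
  "chi n = (\<Sum>i\<le>n. monom 1 i)"


section \<open>Extended Dynkin diagrams that are trees\<close>

datatype ext_dynkin =
    tE6          \<comment> \<open>\<open>E\<^sub>6\<^sup>(\<^sup>1\<^sup>)\<close>\<close>
  | tE7          \<comment> \<open>\<open>E\<^sub>7\<^sup>(\<^sup>1\<^sup>)\<close>\<close>
  | tE8          \<comment> \<open>\<open>E\<^sub>8\<^sup>(\<^sup>1\<^sup>)\<close>\<close>
  | tD nat       \<comment> \<open>\<open>D\<^sub>n\<^sup>(\<^sup>1\<^sup>)\<close>, \<open>n \<ge> 4\<close>\<close>
  | tF41         \<comment> \<open>\<open>E\<^sub>6\<^sup>(\<^sup>2\<^sup>)\<close>\<close>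
  | tF42         \<comment> \<open>\<open>F\<^sub>4\<^sup>(\<^sup>1\<^sup>)\<close>\<close>
  | tCD nat      \<comment> \<open>\<open>B\<^sub>n\<^sup>(\<^sup>1\<^sup>)\<close>, \<open>n \<ge> 3\<close>\<close>
  | tDD nat      \<comment> \<open>\<open>A\<^sub>2\<^sub>n\<^sub>-\<^sub>1\<^sup>(\<^sup>2\<^sup>)\<close>, \<open>n \<ge> 3\<close>\<close>
  | tG21         \<comment> \<open>\<open>D\<^sub>4\<^sup>(\<^sup>3\<^sup>)\<close>\<close>
  | tG22         \<comment> \<open>\<open>G\<^sub>2\<^sup>(\<^sup>1\<^sup>)\<close>\<close>
  | tB nat       \<comment> \<open>\<open>D\<^sub>n\<^sub>+\<^sub>1\<^sup>(\<^sup>2\<^sup>)\<close>, \<open>n \<ge> 2\<close>\<close>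
  | tC nat       \<comment> \<open>\<open>C\<^sub>n\<^sup>(\<^sup>1\<^sup>)\<close>, \<open>n \<ge> 2\<close>\<close>
  | tBC nat      \<comment> \<open>\<open>A\<^sub>2\<^sub>n\<^sup>(\<^sup>2\<^sup>)\<close>, \<open>n \<ge> 2\<close>\<close>
  | tA11         \<comment> \<open>\<open>A\<^sub>2\<^sup>(\<^sup>2\<^sup>)\<close>\<close>
  | tA12         \<comment> \<open>\<open>A\<^sub>1\<^sup>(\<^sup>1\<^sup>)\<close>\<close>

fun is_ext_dynkin :: "ext_dynkin \<Rightarrow> bool" where
  "is_ext_dynkin (tD n) \<longleftrightarrow> n \<ge> 4"
| "is_ext_dynkin (tCD n) \<longleftrightarrow> n \<ge> 3"
| "is_ext_dynkin (tDD n) \<longleftrightarrow> n \<ge> 3"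
| "is_ext_dynkin (tB n) \<longleftrightarrow> n \<ge> 2"
| "is_ext_dynkin (tC n) \<longleftrightarrow> n \<ge> 2"
| "is_ext_dynkin (tBC n) \<longleftrightarrow> n \<ge> 2"
| "is_ext_dynkin _ \<longleftrightarrow> True"

text \<open>
  The vertices are numbered as in Kac's tables of affine diagrams; deleting vertex \<open>0\<close>
  leaves the Dynkin diagram \<open>\<Gamma>\<close>.
\<close>

fun ext_cartan :: "ext_dynkin \<Rightarrow> int mat" where
  "ext_cartan tE6 = cartan_mat 7 (chain 1 5 @ [plain 3 6, plain 6 0])"
| "ext_cartan tE7 = cartan_mat 8 (chain 0 6 @ [plain 3 7])"
| "ext_cartan tE8 = cartan_mat 9 (chain 0 7 @ [plain 5 8])"
| "ext_cartan (tD n) = cartan_mat (n + 1) (plain 0 2 # chain 1 (n - 1) @ [plain (n - 2) n])"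
| "ext_cartan tF41 = cartan_mat 5 (chain 0 2 @ [(2, 3, -2, -1)] @ chain 3 4)"
| "ext_cartan tF42 = cartan_mat 5 (chain 0 2 @ [(2, 3, -1, -2)] @ chain 3 4)"
| "ext_cartan (tCD n) =
     cartan_mat (n + 1) (plain 0 2 # chain 1 (n - 1) @ [(n - 1, n, -1, -2)])"
| "ext_cartan (tDD n) =
     cartan_mat (n + 1) (plain 0 2 # chain 1 (n - 1) @ [(n - 1, n, -2, -1)])"
| "ext_cartan tG21 = cartan_mat 3 [plain 0 1, (1, 2, -3, -1)]"
| "ext_cartan tG22 = cartan_mat 3 [plain 0 1, (1, 2, -1, -3)]"
| "ext_cartan (tB n) =
     cartan_mat (n + 1) ((0, 1, -2, -1) # chain 1 (n - 1) @ [(n - 1, n, -1, -2)])"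
| "ext_cartan (tC n) =
     cartan_mat (n + 1) ((0, 1, -1, -2) # chain 1 (n - 1) @ [(n - 1, n, -2, -1)])"
| "ext_cartan (tBC n) =
     cartan_mat (n + 1) ((0, 1, -2, -1) # chain 1 (n - 1) @ [(n - 1, n, -2, -1)])"
| "ext_cartan tA11 = cartan_mat 2 [(0, 1, -4, -1)]"
| "ext_cartan tA12 = cartan_mat 2 [(0, 1, -2, -2)]"

fun ext_class :: "ext_dynkin \<Rightarrow> nat" where
  "ext_class tE6 = 0"
| "ext_class tE7 = 0"
| "ext_class tE8 = 0"
| "ext_class (tD n) = 0"
| "ext_class tF41 = 1"
| "ext_class tF42 = 1"
| "ext_class (tCD n) = 1"
| "ext_class (tDD n) = 1"
| "ext_class tG21 = 2"
| "ext_class tG22 = 2"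
| "ext_class (tB n) = 2"
| "ext_class (tC n) = 2"
| "ext_class (tBC n) = 2"
| "ext_class tA11 = 3"
| "ext_class tA12 = 3"

text \<open>
  The branch lengths \<open>p, q, r\<close>. The branch point is counted in each length, so a branch of
  length \<open>p\<close> is of type \<open>A\<^sub>p\<^sub>-\<^sub>1\<close>. They depend on the extended diagram and not only on \<open>\<Gamma>\<close>:
  for \<open>tCD n\<close> and \<open>tB n\<close> the diagram \<open>\<Gamma>\<close> is \<open>B\<^sub>n\<close> in both cases.
\<close>

fun branch_lengths :: "ext_dynkin \<Rightarrow> nat list" where
  "branch_lengths tE6 = [2, 3, 3]"
| "branch_lengths tE7 = [2, 3, 4]"
| "branch_lengths tE8 = [2, 3, 5]"
| "branch_lengths (tD n) = [2, 2, n - 2]"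
| "branch_lengths tF41 = [2, 3]"
| "branch_lengths tF42 = [2, 3]"
| "branch_lengths (tCD n) = [2, n - 1]"
| "branch_lengths (tDD n) = [2, n - 1]"
| "branch_lengths tG21 = [2]"
| "branch_lengths tG22 = [2]"
| "branch_lengths (tB n) = [n]"
| "branch_lengths (tC n) = [n]"
| "branch_lengths (tBC n) = [n]"
| "branch_lengths tA11 = []"
| "branch_lengths tA12 = []"

end

theory Submission
  imports Defs
begin

text \<open>
  Order the vertices as in the product of reflections defining the Coxeter transformation \<open>C\<close>, and
  split the Cartan matrix as \<open>K = U + V\<close> into an upper and a lower unitriangular part. Applying the
  reflections one after the other means solving \<open>U C = - V\<close>, so the characteristic polynomial of
  \<open>C\<close> is \<open>det (\<lambda> U + V)\<close> (lemma \<open>char_poly_reflection_product\<close>).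

  The matrix \<open>\<lambda> U + V\<close> has diagonal entries \<open>\<lambda> + 1\<close>, and its entries at \<open>(i, j)\<close> and \<open>(j, i)\<close> have
  the product \<open>k\<^sub>i\<^sub>j k\<^sub>j\<^sub>i \<lambda>\<close>, whichever of \<open>i\<close> and \<open>j\<close> comes first. If \<open>v\<close> is a leaf attached to \<open>u\<close>,
  expanding the determinant at \<open>v\<close> gives (lemma \<open>P_leaf\<close>)
  \<open>P (\<Gamma>) = (\<lambda> + 1) P (\<Gamma> - v) - k\<^sub>u\<^sub>v k\<^sub>v\<^sub>u \<lambda> P (\<Gamma> - u - v)\<close>.
  As a tree can be taken apart leaf by leaf, the polynomial does not depend on the order, nor on
  the direction of the arrows: only the products \<open>k\<^sub>i\<^sub>j k\<^sub>j\<^sub>i\<close> matter. So the diagrams fall into a few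
  families, and the families with a parameter reduce to a two-step linear recursion whose solutions
  are combinations of \<open>1\<close> and \<open>\<lambda> ^ k\<close>. The values are \<open>\<chi>\<^sub>k\<close> for \<open>A\<^sub>k\<close>, \<open>(\<lambda> + 1) (\<lambda> ^ (k - 1) + 1)\<close>
  for \<open>D\<^sub>k\<close> and \<open>\<lambda> ^ k + 1\<close> for \<open>B\<^sub>k\<close> and \<open>C\<^sub>k\<close>. In these
  families the affine diagram has one more leaf, and \<open>(\<lambda> - 1) \<chi>\<^sub>k = \<lambda> ^ (k + 1) - 1\<close> brings the
  result into the stated form.

  The eigenvalues of the product of the branch transformations are the roots of the product of
  their characteristic polynomials, because the matrix is block diagonal.
\<close>

section \<open>Principal minors indexed by vertex sets\<close>

text \<open>
  The Leibniz formula is indexed by a set of vertices, so that removing vertices from a diagram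
  needs no renumbering of rows and columns.
\<close>

definition minor_det :: "(nat \<Rightarrow> nat \<Rightarrow> 'a :: comm_ring_1) \<Rightarrow> nat set \<Rightarrow> 'a" where
  "minor_det m S = (\<Sum>p | p permutes S. of_int (sign p) * (\<Prod>i\<in>S. m i (p i)))"

lemma minor_det_empty [simp]: "minor_det m {} = 1"
  by (simp add: minor_det_def)

lemma det_mat_eq_minor_det: "det (mat n n (\<lambda>(i, j). m i j)) = minor_det m {..<n}"
proof -
  have "(\<Prod>i = 0..<n. mat n n (\<lambda>(i, j). m i j) $$ (i, p i)) = (\<Prod>i = 0..<n. m i (p i))"
    if "p permutes {0..<n}" for p
    using permutes_in_image[OF that] by (intro prod.cong) auto
  then have "det (mat n n (\<lambda>(i, j). m i j)) =
      (\<Sum>p | p permutes {0..<n}. of_int (sign p) * (\<Prod>i = 0..<n. m i (p i)))"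
    by (simp add: det_def'[of _ n])
  then show ?thesis
    by (simp add: minor_det_def atLeast0LessThan)
qed

lemma permutes_insert_fixed:
  assumes "v \<notin> S"
  shows "{p. p permutes insert v S \<and> p v = v} = {p. p permutes S}"
  using assms by (auto simp: permutes_def)

lemma sum_fixing_permutations:
  fixes m :: "nat \<Rightarrow> nat \<Rightarrow> 'a :: comm_ring_1"
  assumes "finite S" "v \<notin> S"
  shows "(\<Sum>p | p permutes insert v S \<and> p v = v. of_int (sign p) * (\<Prod>i\<in>insert v S. m i (p i)))
    = m v v * minor_det m S"
proof -
  have "(\<Prod>i\<in>insert v S. m i (p i)) = m v v * (\<Prod>i\<in>S. m i (p i))" if "p permutes S" for p
    using assms permutes_not_in[OF that assms(2)] by simp
  then show ?thesis
    unfolding permutes_insert_fixed[OF assms(2)] minor_det_def sum_distrib_left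
    by (intro sum.cong) (auto simp: algebra_simps)
qed

text \<open>
  A permutation that moves \<open>v\<close> picks an off-diagonal entry of column \<open>v\<close>, so only the permutations
  that fix \<open>v\<close> contribute.
\<close>

lemma minor_det_insert_zero_column:
  fixes m :: "nat \<Rightarrow> nat \<Rightarrow> 'a :: comm_ring_1"
  assumes S: "finite S" "v \<notin> S" and zero: "\<And>i. i \<in> S \<Longrightarrow> m i v = 0"
  shows "minor_det m (insert v S) = m v v * minor_det m S"
proof -
  have "(\<Prod>i\<in>insert v S. m i (p i)) = 0" if p: "p permutes insert v S" and "p v \<noteq> v" for p
  proof -
    have "v \<in> p ` insert v S"
      unfolding permutes_image[OF p] by simp
    then obtain i where i: "i \<in> insert v S" "p i = v"
      by (elim imageE) simp
    with \<open>p v \<noteq> v\<close> have "m i (p i) = 0"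
      using zero by auto
    with i(1) show ?thesis
      using S(1) by (intro prod_zero) auto
  qed
  then have "minor_det m (insert v S) =
      (\<Sum>p | p permutes insert v S \<and> p v = v. of_int (sign p) * (\<Prod>i\<in>insert v S. m i (p i)))"
    unfolding minor_det_def
    by (intro sum.mono_neutral_right) (auto simp: finite_permutations S(1))
  then show ?thesis
    using sum_fixing_permutations[OF S] by simp
qed

text \<open>
  The recursion for a leaf \<open>v\<close> attached to \<open>u\<close>. A contributing permutation that moves \<open>v\<close> must
  leave row \<open>v\<close> through \<open>u\<close> and enter column \<open>v\<close> from \<open>u\<close>; it therefore swaps \<open>u\<close> and \<open>v\<close>, and the
  remaining factor permutes \<open>S - {u}\<close>. The two entries occur only through their product, and this is
  what makes the order of the reflections irrelevant.
\<close>

lemma minor_det_insert_leaf: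
  fixes m :: "nat \<Rightarrow> nat \<Rightarrow> 'a :: comm_ring_1"
  assumes S: "finite S" "v \<notin> S" and u: "u \<in> S"
    and row: "\<And>j. j \<in> S - {u} \<Longrightarrow> m v j = 0"
    and col: "\<And>j. j \<in> S - {u} \<Longrightarrow> m j v = 0"
  shows "minor_det m (insert v S) =
    m v v * minor_det m S - m u v * m v u * minor_det m (S - {u})"
proof -
  let ?t = "\<lambda>p. of_int (sign p) * (\<Prod>i\<in>insert v S. m i (p i))"
  let ?fix = "{p. p permutes insert v S \<and> p v = v}"
  let ?swap = "{p. p permutes insert v S \<and> p v = u \<and> p u = v}"
  let ?R = "{q. q permutes (S - {u})}"
  have uv: "u \<noteq> v" using u S(2) by auto
  have zero: "(\<Prod>i\<in>insert v S. m i (p i)) = 0"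
    if p: "p permutes insert v S" and pv: "p v \<noteq> v" and not_swap: "\<not> (p v = u \<and> p u = v)" for p
  proof (cases "p v = u")
    case False
    have "p v \<in> insert v S"
      using permutes_in_image[OF p, of v] by simp
    with False pv have "m v (p v) = 0"
      by (intro row) auto
    then show ?thesis
      using S(1) by (intro prod_zero) auto
  next
    case True
    with not_swap have "p u \<noteq> v" by simp
    have "v \<in> p ` insert v S"
      unfolding permutes_image[OF p] by simp
    then obtain i where i: "i \<in> insert v S" "p i = v"
      by (elim imageE) simp
    with pv \<open>p u \<noteq> v\<close> have "i \<in> S - {u}" by auto
    then have "m i (p i) = 0"
      using col i(2) by simp
    with i(1) show ?thesis
      using S(1) by (intro prod_zero) auto
  qed
  have "minor_det m (insert v S) = sum ?t (?fix \<union> ?swap)"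
    unfolding minor_det_def
    using zero by (intro sum.mono_neutral_right) (auto simp: finite_permutations S(1))
  also have "\<dots> = sum ?t ?fix + sum ?t ?swap"
    using uv S(1)
    by (intro sum.union_disjoint)
      (auto intro: finite_subset[OF _ finite_permutations[of "insert v S"]])
  also have "sum ?t ?swap = - (m u v * m v u * minor_det m (S - {u}))"
  proof -
    \<comment> \<open>Composing with the transposition of \<open>u\<close> and \<open>v\<close> removes the swap, and is its own inverse.\<close>
    have bij: "bij_betw (\<lambda>q. transpose u v \<circ> q) ?R ?swap"
    proof (rule bij_betw_byWitness[where f' = "\<lambda>q. transpose u v \<circ> q"])
      show "(\<lambda>q. transpose u v \<circ> q) ` ?R \<subseteq> ?swap"
      proof safe
        fix q assume q: "q permutes S - {u}"
        have q': "q permutes insert v S"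
          by (rule permutes_subset[OF q]) auto
        show "transpose u v \<circ> q permutes insert v S"
          using u by (intro permutes_compose[OF q'] permutes_swap_id) auto
        show "(transpose u v \<circ> q) v = u" "(transpose u v \<circ> q) u = v"
          using permutes_not_in[OF q] S(2) by auto
      qed
      show "(\<lambda>q. transpose u v \<circ> q) ` ?swap \<subseteq> ?R"
      proof safe
        fix p assume p: "p permutes insert v S" "u = p v" "p (p v) = v"
        have "transpose (p v) v \<circ> p permutes insert v S"
          using u p by (intro permutes_compose[OF p(1)] permutes_swap_id) auto
        then show "transpose (p v) v \<circ> p permutes S - {p v}"
          by (rule permutes_superset) (use p in auto)
      qed
    qed (auto simp: fun_eq_iff)
    have swapped: "?t (transpose u v \<circ> q) =
        - (m u v * m v u * (of_int (sign q) * (\<Prod>i\<in>S - {u}. m i (q i))))"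
      if q: "q permutes S - {u}" for q
    proof -
      have "permutation q"
        using q S(1) by (auto simp: permutation_permutes)
      then have sgn: "sign (transpose u v \<circ> q) = - sign q"
        using uv by (simp add: sign_compose sign_swap_id permutation_swap_id)
      have fixed: "q u = u" "q v = v"
        using permutes_not_in[OF q] S(2) by auto
      have rest: "(transpose u v \<circ> q) i = q i" if "i \<in> S - {u}" for i
        using permutes_in_image[OF q, of i] that S(2) by (auto simp: transpose_def)
      have "(\<Prod>i\<in>insert v S. m i ((transpose u v \<circ> q) i)) =
          m v u * (\<Prod>i\<in>S. m i ((transpose u v \<circ> q) i))"
        using S fixed by simp
      also have "\<dots> = m v u * (m u v * (\<Prod>i\<in>S - {u}. m i ((transpose u v \<circ> q) i)))"
        by (subst prod.remove[OF S(1) u]) (simp add: fixed)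
      also have "(\<Prod>i\<in>S - {u}. m i ((transpose u v \<circ> q) i)) = (\<Prod>i\<in>S - {u}. m i (q i))"
        using rest by (intro prod.cong) auto
      finally show ?thesis
        unfolding sgn by (simp add: algebra_simps)
    qed
    have "sum ?t ?swap = (\<Sum>q\<in>?R. ?t (transpose u v \<circ> q))"
      by (rule sum.reindex_bij_betw[OF bij, symmetric])
    also have "\<dots> = (\<Sum>q\<in>?R. - (m u v * m v u * (of_int (sign q) * (\<Prod>i\<in>S - {u}. m i (q i)))))"
      using swapped by (intro sum.cong) auto
    finally show ?thesis
      by (simp add: minor_det_def sum_negf sum_distrib_left)
  qed
  finally show ?thesis
    using sum_fixing_permutations[OF S, of m] by simp
qed

section \<open>The characteristic polynomial of a product of all reflections\<close>

fun before :: "nat list \<Rightarrow> nat \<Rightarrow> nat \<Rightarrow> bool" where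
  "before [] i j \<longleftrightarrow> False"
| "before (a # w) i j \<longleftrightarrow> (if i = a then j \<in> set w else before w i j)"

lemma before_imp_mem: "before w i j \<Longrightarrow> i \<in> set w \<and> j \<in> set w"
  by (induction w) (auto split: if_splits)

lemma before_irrefl: "distinct w \<Longrightarrow> \<not> before w i i"
  by (induction w) auto

lemma before_antisym:
  "distinct w \<Longrightarrow> i \<in> set w \<Longrightarrow> j \<in> set w \<Longrightarrow> i \<noteq> j \<Longrightarrow> before w j i \<longleftrightarrow> \<not> before w i j"
  by (induction w) (auto dest: before_imp_mem)

text \<open>
  Read in the order \<open>w\<close>, the matrix is upper unitriangular: the first vertex has a zero column
  off the diagonal and can be removed.
\<close>

lemma minor_det_unitriangular:
  fixes U :: "nat \<Rightarrow> nat \<Rightarrow> 'a :: comm_ring_1"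
  assumes "distinct w" "\<And>i. i \<in> set w \<Longrightarrow> U i i = 1"
    and "\<And>i j. i \<in> set w \<Longrightarrow> j \<in> set w \<Longrightarrow> i \<noteq> j \<Longrightarrow> \<not> before w i j \<Longrightarrow> U i j = 0"
  shows "minor_det U (set w) = 1"
  using assms
proof (induction w)
  case (Cons a w)
  have "minor_det U (set w) = 1"
  proof (rule Cons.IH)
    fix i j assume ij: "i \<in> set w" "j \<in> set w" "i \<noteq> j" "\<not> before w i j"
    with Cons.prems(1) have "\<not> before (a # w) i j" by auto
    with ij show "U i j = 0" by (intro Cons.prems(3)) auto
  qed (use Cons.prems in auto)
  moreover have "U i a = 0" if "i \<in> set w" for i
    using Cons.prems that by (intro Cons.prems(3)) (auto dest: before_imp_mem)
  ultimately show ?case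
    using Cons.prems by (simp add: minor_det_insert_zero_column)
qed simp

lemma simple_reflection_index:
  assumes K: "K \<in> carrier_mat n n" and z: "z \<in> carrier_vec n" and "a < n" "i < n"
  shows "simple_reflection K a z $ i =
    (if i = a then z $ i - (\<Sum>j<n. of_int (K $$ (a, j)) * z $ j) else z $ i)"
  using assms
  by (auto simp: simple_reflection_def scalar_prod_def atLeast0LessThan unit_vec_def)

lemma simple_reflection_closed:
  assumes "K \<in> carrier_mat n n" "z \<in> carrier_vec n"
  shows "simple_reflection K a z \<in> carrier_vec n"
  using assms by (auto simp: simple_reflection_def)

lemma reflections_closed:
  assumes "K \<in> carrier_mat n n" "z \<in> carrier_vec n"
  shows "foldr (simple_reflection K) w z \<in> carrier_vec n"
  by (induction w) (auto simp: assms simple_reflection_closed)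

text \<open>
  The reflections are applied from the end of \<open>w\<close>, and coordinate \<open>i\<close> changes only in the step of
  \<open>\<sigma>\<^sub>i\<close>. At that moment the coordinates of the vertices behind \<open>i\<close> in \<open>w\<close> already have their final
  values, and all other ones still have their initial values. This is an implicit (Gauss-Seidel type)
  linear system for the image.
\<close>

lemma reflections_index:
  assumes K: "K \<in> carrier_mat n n" and z: "z \<in> carrier_vec n"
    and "distinct w" "set w \<subseteq> {..<n}" "i < n"
  shows "foldr (simple_reflection K) w z $ i =
    (if i \<in> set w
     then z $ i - (\<Sum>j<n. of_int (K $$ (i, j)) *
       (if before w i j then foldr (simple_reflection K) w z $ j else z $ j))
     else z $ i)"
  using assms(3-5)
proof (induction w arbitrary: i)
  case (Cons a w)
  let ?y = "foldr (simple_reflection K) w z"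
  have y: "?y \<in> carrier_vec n" by (rule reflections_closed[OF K z])
  have a: "a < n" "a \<notin> set w" using Cons.prems by auto
  have outside: "?y $ j = z $ j" if "j \<notin> set w" "j < n" for j
    using Cons.IH[of j] Cons.prems that by auto
  define y' where "y' = simple_reflection K a ?y"
  have step: "y' $ j = (if j = a then ?y $ j - (\<Sum>l<n. of_int (K $$ (a, l)) * ?y $ l) else ?y $ j)"
    if "j < n" for j
    unfolding y'_def by (rule simple_reflection_index[OF K y a(1) that])
  have y': "foldr (simple_reflection K) (a # w) z = y'"
    by (simp add: y'_def)
  show ?case
  proof (cases "i = a")
    case True
    have "(\<Sum>j<n. of_int (K $$ (a, j)) * ?y $ j) =
        (\<Sum>j<n. of_int (K $$ (a, j)) * (if before (a # w) a j then y' $ j else z $ j))"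
      using a outside by (intro sum.cong) (auto simp: step)
    then show ?thesis
      unfolding y' True using a outside[OF a(2,1)] step[OF a(1)] by simp
  next
    case False
    have "(\<Sum>j<n. of_int (K $$ (i, j)) * (if before w i j then ?y $ j else z $ j)) =
        (\<Sum>j<n. of_int (K $$ (i, j)) * (if before (a # w) i j then y' $ j else z $ j))"
      using a False by (intro sum.cong) (auto simp: step dest: before_imp_mem)
    moreover have "y' $ i = ?y $ i"
      using step[of i] False Cons.prems by simp
    ultimately show ?thesis
      unfolding y' using False Cons.IH[of i] Cons.prems by simp
  qed
qed simp

text \<open>
  The matrix \<open>\<lambda> U + V\<close>, where \<open>K = U + V\<close> and \<open>U\<close> and \<open>V\<close> are the upper and the lower
  unitriangular part of \<open>K\<close> with respect to the order \<open>w\<close>.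
\<close>

definition coxeter_pencil :: "int mat \<Rightarrow> nat list \<Rightarrow> nat \<Rightarrow> nat \<Rightarrow> complex poly" where
  "coxeter_pencil K w i j =
     (if i = j then [:1, 1:]
      else if before w i j then [:0, of_int (K $$ (i, j)):] else [:of_int (K $$ (i, j)):])"

text \<open>
  The linear system for the image of a vector says \<open>U C = - V\<close>. Hence
  \<open>U (\<lambda> - C) = \<lambda> U + V\<close>, and \<open>det U = 1\<close>.
\<close>

lemma char_poly_reflection_product:
  assumes K: "K \<in> carrier_mat n n" and diag: "\<And>i. i < n \<Longrightarrow> K $$ (i, i) = 2"
    and w: "distinct w" "set w = {..<n}"
  shows "char_poly (reflection_product K w) = minor_det (coxeter_pencil K w) {..<n}"
proof -
  define C where "C = reflection_product K w"
  define U :: "nat \<Rightarrow> nat \<Rightarrow> complex" where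
    "U i j = (if i = j then 1 else if before w i j then of_int (K $$ (i, j)) else 0)" for i j
  define V :: "nat \<Rightarrow> nat \<Rightarrow> complex" where
    "V i j = (if i = j then 1 else if before w i j then 0 else of_int (K $$ (i, j)))" for i j
  have dimK [simp]: "dim_row K = n" using K by simp
  have C [simp]: "C \<in> carrier_mat n n"
    by (simp add: C_def reflection_product_def mat_of_cols_def)
  have C_index: "C $$ (i, j) = foldr (simple_reflection K) w (unit_vec n j) $ i"
    if "i < n" "j < n" for i j
    using that by (simp add: C_def reflection_product_def mat_of_cols_def)
  have UC: "(\<Sum>l<n. U i l * C $$ (l, j)) = - V i j" if ij: "i < n" "j < n" for i j
  proof -
    let ?z = "unit_vec n j :: complex vec"
    define y where "y = foldr (simple_reflection K) w ?z"
    have "y $ i = ?z $ i - (\<Sum>l<n. of_int (K $$ (i, l)) * (if before w i l then y $ l else ?z $ l))"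
      using reflections_index[OF K, of ?z w i] w ij unfolding y_def by simp
    also have "(\<Sum>l<n. of_int (K $$ (i, l)) * (if before w i l then y $ l else ?z $ l)) =
       (\<Sum>l<n. (U i l * y $ l - (if l = i then y $ l else 0)) +
         (V i l * ?z $ l + (if l = i then ?z $ l else 0)))"
      using before_irrefl[OF w(1)] diag by (intro sum.cong) (auto simp: U_def V_def)
    also have "\<dots> = (\<Sum>l<n. U i l * y $ l) - y $ i + ((\<Sum>l<n. V i l * ?z $ l) + ?z $ i)"
      using ij by (simp add: sum.distrib sum_subtractf)
    also have "(\<Sum>l<n. V i l * ?z $ l) = (\<Sum>l<n. if l = j then V i l else 0)"
      using ij by (intro sum.cong) auto
    finally have "(\<Sum>l<n. U i l * y $ l) = - V i j"
      using ij by (simp add: eq_neg_iff_add_eq_0 add.commute)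
    moreover have "(\<Sum>l<n. U i l * C $$ (l, j)) = (\<Sum>l<n. U i l * y $ l)"
      using ij by (intro sum.cong) (auto simp: C_index y_def)
    ultimately show ?thesis by simp
  qed
  let ?U = "mat n n (\<lambda>(i, j). [:U i j:])"
  let ?M = "mat n n (\<lambda>(i, j). coxeter_pencil K w i j)"
  have "?U * char_poly_matrix C = ?M"
  proof (rule eq_matI)
    fix i j assume "i < dim_row ?M" "j < dim_col ?M"
    then have ij: "i < n" "j < n" by auto
    have "(?U * char_poly_matrix C) $$ (i, j) =
        (\<Sum>l<n. [:U i l:] * ((if l = j then [:0, 1:] else 0) + [:- C $$ (l, j):]))"
      using ij carrier_matD[OF C] by (auto simp: char_poly_matrix_def scalar_prod_def atLeast0LessThan
        intro!: sum.cong)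
    also have "\<dots> = (\<Sum>l<n. (if l = j then [:0, U i l:] else 0)) - (\<Sum>l<n. [:U i l * C $$ (l, j):])"
      unfolding sum_subtractf[symmetric] by (intro sum.cong) auto
    also have "(\<Sum>l<n. [:U i l * C $$ (l, j):]) = [:\<Sum>l<n. U i l * C $$ (l, j):]"
      by (induction n) auto
    also have "\<dots> = [:- V i j:]"
      using UC[OF ij] by simp
    finally show "(?U * char_poly_matrix C) $$ (i, j) = ?M $$ (i, j)"
      using ij by (simp add: coxeter_pencil_def U_def V_def)
  qed (use carrier_matD[OF C] in \<open>auto simp: char_poly_matrix_def\<close>)
  then have "det ?U * char_poly C = det ?M"
    unfolding char_poly_def by (subst det_mult[of _ n, symmetric]) auto
  moreover have "det ?U = minor_det (\<lambda>i j. [:U i j:]) (set w)"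
    unfolding w(2) by (rule det_mat_eq_minor_det)
  moreover have "\<dots> = 1"
    by (rule minor_det_unitriangular[OF w(1)]) (auto simp: U_def)
  ultimately show ?thesis
    by (simp add: det_mat_eq_minor_det C_def)
qed

section \<open>Cartan entries of chains\<close>

lemma cartan_entry_append_chain:
  "cartan_entry (chain a b @ es) i j =
    (if a \<le> min i j \<and> max i j \<le> b \<and> (j = Suc i \<or> i = Suc j) then - 1 else cartan_entry es i j)"
proof -
  have "cartan_entry (map (\<lambda>k. plain k (Suc k)) xs @ es) i j =
      (if (i \<in> set xs \<and> j = Suc i) \<or> (j \<in> set xs \<and> i = Suc j) then - 1 else cartan_entry es i j)"
    for xs
    by (induction xs) auto
  then show ?thesis
    unfolding chain_def by (auto simp: min_def max_def)
qed

lemma cartan_entry_chain: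
  "cartan_entry (chain a b) i j =
    (if a \<le> min i j \<and> max i j \<le> b \<and> (j = Suc i \<or> i = Suc j) then - 1
     else if i = j then 2 else 0)"
  using cartan_entry_append_chain[of a b "[]"] by simp

lemmas cartan_entry_simps = cartan_entry_append_chain cartan_entry_chain

lemma cartan_entry_diag: "\<forall>(i, j, a, b)\<in>set es. i \<noteq> j \<Longrightarrow> cartan_entry es v v = 2"
  by (induction es) auto

section \<open>The polynomials of type A\<close>

text \<open>
  The variable is a constant of its own because the simplifier turns a product with \<open>[:0, 1:]\<close> into
  \<open>pCons\<close>, which hides polynomial identities from ring normalization.
\<close>

definition X :: "complex poly" where "X = [:0, 1:]"

lemma chi_0 [simp]: "chi 0 = 1"
  by (simp add: chi_def)

lemma chi_Suc: "chi (Suc n) = X * chi n + 1"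
proof -
  have "chi (Suc n) = monom 1 0 + (\<Sum>i\<le>n. monom 1 (Suc i))"
    unfolding chi_def by (rule sum.atMost_Suc_shift)
  also have "(\<Sum>i\<le>n. monom 1 (Suc i)) = X * chi n"
    unfolding chi_def sum_distrib_left by (simp add: monom_Suc X_def)
  finally show ?thesis by simp
qed

lemma chi_small:
  "chi 1 = X + 1" "chi (Suc 0) = X + 1" "chi 2 = X ^ 2 + X + 1"
  "chi 3 = X ^ 3 + X ^ 2 + X + 1" "chi 4 = X ^ 4 + X ^ 3 + X ^ 2 + X + 1"
  "chi 5 = X ^ 5 + X ^ 4 + X ^ 3 + X ^ 2 + X + 1"
  "chi 7 = X ^ 7 + X ^ 6 + X ^ 5 + X ^ 4 + X ^ 3 + X ^ 2 + X + 1"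
  "chi 8 = X ^ 8 + X ^ 7 + X ^ 6 + X ^ 5 + X ^ 4 + X ^ 3 + X ^ 2 + X + 1"
  by (simp_all add: chi_Suc eval_nat_numeral algebra_simps)

lemma chi_times: "(X - 1) * chi n = X ^ Suc n - 1"
  by (induction n) (auto simp: chi_Suc algebra_simps)

section \<open>Recursions for the Coxeter polynomial of a diagram\<close>

text \<open>
  A diagram together with an order in which its vertices are reflected. The pencil entries \<open>m\<^sub>i\<^sub>j\<close> and
  \<open>m\<^sub>j\<^sub>i\<close> depend on the order, but their product \<open>k\<^sub>i\<^sub>j k\<^sub>j\<^sub>i \<lambda>\<close> does not; so the
  recursions for the minors \<open>P S\<close> can be stated with the weights \<open>k\<^sub>i\<^sub>j k\<^sub>j\<^sub>i\<close>.
\<close>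

locale ordered_diagram =
  fixes n :: nat and es :: "valued_edge list" and w :: "nat list"
  assumes distinct: "distinct w" and vertices: "set w = {..<n}"
    and loopless: "\<forall>(i, j, a, b)\<in>set es. i \<noteq> j"
begin

abbreviation weight :: "nat \<Rightarrow> nat \<Rightarrow> int" where
  "weight i j \<equiv> cartan_entry es i j * cartan_entry es j i"

abbreviation nonadjacent :: "nat \<Rightarrow> nat \<Rightarrow> bool" where
  "nonadjacent i j \<equiv> cartan_entry es i j = 0 \<and> cartan_entry es j i = 0"

definition P :: "nat set \<Rightarrow> complex poly" where
  "P S = minor_det (coxeter_pencil (cartan_mat n es) w) S"

lemma char_poly_eq: "char_poly (reflection_product (cartan_mat n es) w) = P {..<n}"
  unfolding P_def
  by (rule char_poly_reflection_product)
    (auto simp: cartan_mat_def distinct vertices cartan_entry_diag[OF loopless])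

lemma pencil_zero:
  "i < n \<Longrightarrow> j < n \<Longrightarrow> i \<noteq> j \<Longrightarrow> cartan_entry es i j = 0 \<Longrightarrow>
    coxeter_pencil (cartan_mat n es) w i j = 0"
  by (simp add: coxeter_pencil_def cartan_mat_def)

lemma pencil_diag: "coxeter_pencil (cartan_mat n es) w i i = X + 1"
  by (simp add: coxeter_pencil_def X_def one_pCons)

lemma pencil_times:
  assumes "i < n" "j < n" "i \<noteq> j"
  shows "coxeter_pencil (cartan_mat n es) w i j * coxeter_pencil (cartan_mat n es) w j i =
    of_int (weight i j) * X"
  using assms before_antisym[OF distinct, of i j] vertices
  by (auto simp: coxeter_pencil_def cartan_mat_def X_def of_int_poly)

lemma P_empty [simp]: "P {} = 1"
  by (simp add: P_def)

lemma P_isolated: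
  assumes "insert v S \<subseteq> {..<n}" "v \<notin> S" "\<And>j. j \<in> S \<Longrightarrow> nonadjacent v j"
  shows "P (insert v S) = (X + 1) * P S"
  unfolding P_def pencil_diag[of v, symmetric]
  using assms finite_subset[of S "{..<n}"]
  by (intro minor_det_insert_zero_column) (auto intro!: pencil_zero)

lemma P_leaf:
  assumes "insert v S \<subseteq> {..<n}" "v \<notin> S" "u \<in> S" "weight u v = c"
    and "\<And>j. j \<in> S - {u} \<Longrightarrow> nonadjacent v j"
  shows "P (insert v S) = (X + 1) * P S - of_int c * X * P (S - {u})"
proof -
  let ?m = "coxeter_pencil (cartan_mat n es) w"
  have "P (insert v S) = ?m v v * P S - ?m u v * ?m v u * P (S - {u})"
    unfolding P_def
    using assms finite_subset[of S "{..<n}"]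
    by (intro minor_det_insert_leaf) (auto intro!: pencil_zero)
  moreover have "?m u v * ?m v u = of_int c * X"
    using assms by (subst pencil_times) auto
  ultimately show ?thesis
    by (simp add: pencil_diag)
qed

text \<open>
  The chain is built up leaf by leaf, and \<open>chi\<close> satisfies the leaf recursion
  \<open>f (k + 2) = (X + 1) * f (k + 1) - X * f k\<close>.
\<close>

lemma P_disjoint_chain:
  assumes "S \<union> {a..<b} \<subseteq> {..<n}" "a \<le> b" "S \<inter> {a..<b} = {}"
    and "\<And>i j. i \<in> S \<Longrightarrow> j \<in> {a..<b} \<Longrightarrow> nonadjacent i j"
    and "\<And>i j. a \<le> i \<Longrightarrow> i < j \<Longrightarrow> j < b \<Longrightarrow> if j = Suc i then weight i j = 1 else nonadjacent i j"
  shows "P (S \<union> {a..<b}) = P S * chi (b - a)"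
proof -
  have bound: "x < n" if "a \<le> x" "x < b" for x
    using assms(1) that by auto
  have "P (S \<union> {a..<a + d}) = P S * chi d" if "a + d \<le> b" for d
    using that
  proof (induction d rule: induct_nat_012)
    case 1
    have "P (insert a S) = (X + 1) * P S"
      using assms 1 bound by (intro P_isolated) auto
    then show ?case
      by (simp add: chi_Suc algebra_simps)
  next
    case (ge2 d)
    let ?T = "S \<union> {a..<Suc (a + d)}"
    have "P (insert (Suc (a + d)) ?T) = (X + 1) * P ?T - of_int 1 * X * P (?T - {a + d})"
    proof (rule P_leaf)
      show "weight (a + d) (Suc (a + d)) = 1"
        using assms(5)[of "a + d" "Suc (a + d)"] ge2.prems by simp
      fix j assume "j \<in> ?T - {a + d}"
      then have "j \<in> S \<or> a \<le> j \<and> j < a + d" by auto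
      then show "nonadjacent (Suc (a + d)) j"
        using assms(4)[of j "Suc (a + d)"] assms(5)[of j "Suc (a + d)"] ge2.prems by auto
    qed (use assms ge2.prems bound in auto)
    moreover have "insert (Suc (a + d)) ?T = S \<union> {a..<a + Suc (Suc d)}" by auto
    moreover have "?T - {a + d} = S \<union> {a..<a + d}"
      using assms(3) ge2.prems by auto
    ultimately show ?case
      using ge2 by (simp add: chi_Suc algebra_simps)
  qed simp
  from this[of "b - a"] show ?thesis
    using assms(2) by simp
qed

lemma P_chain:
  assumes "b \<le> n" "a \<le> b"
    and "\<And>i j. a \<le> i \<Longrightarrow> i < j \<Longrightarrow> j < b \<Longrightarrow> if j = Suc i then weight i j = 1 else nonadjacent i j"
  shows "P {a..<b} = chi (b - a)"
proof -
  have "P ({} \<union> {a..<b}) = P {} * chi (b - a)"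
    by (rule P_disjoint_chain) (use assms(1,2) in \<open>simp_all add: assms(3) subset_iff\<close>)
  then show ?thesis by simp
qed

lemma P_extend:
  assumes "Suc (Suc k) \<le> n" "weight k (Suc k) = c" "\<And>j. j < k \<Longrightarrow> nonadjacent j (Suc k)"
  shows "P {..<Suc (Suc k)} = (X + 1) * P {..<Suc k} - of_int c * X * P {..<k}"
proof -
  have "{..<Suc k} - {k} = {..<k}" by auto
  moreover have "P (insert (Suc k) {..<Suc k}) =
      (X + 1) * P {..<Suc k} - of_int c * X * P ({..<Suc k} - {k})"
    using assms by (intro P_leaf) auto
  ultimately show ?thesis
    by (simp only: lessThan_Suc[symmetric])
qed

text \<open>
  Type \<open>D\<^sub>k\<close>, with vertices \<open>0\<close> and \<open>1\<close> both attached to \<open>2\<close>. The solutions of the leaf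
  recursion have the form \<open>A + B * X ^ k\<close>; the two initial cases determine \<open>A\<close> and \<open>B\<close>. For
  \<open>k = 2\<close> the diagram consists of two isolated vertices.
\<close>

lemma P_fork:
  assumes "2 \<le> k" "k \<le> n"
    and "\<And>i j. i < j \<Longrightarrow> j < k \<Longrightarrow>
      if i = 0 \<and> j = 2 \<or> 0 < i \<and> j = Suc i then weight i j = 1 else nonadjacent i j"
  shows "P {..<k} = (X + 1) * (X ^ (k - 1) + 1)"
proof -
  have "P {..<d + 2} = (X + 1) * (X ^ (d + 1) + 1)" if "d + 2 \<le> k" for d
    using that
  proof (induction d rule: induct_nat_012)
    case 0
    have "P {0..<1} = X + 1"
      using assms(2) 0 by (subst P_chain) (auto simp: chi_Suc)
    moreover have "P (insert 1 {0..<1}) = (X + 1) * P {0..<1}"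
      using assms(2) assms(3)[of 0 1] 0 by (intro P_isolated) auto
    moreover have "insert 1 {0..<1} = {..<0 + 2::nat}" by auto
    ultimately show ?case by simp
  next
    case 1
    have adj: "weight 1 2 = 1"
      using assms(3)[of 1 2] 1 by simp
    have edge: "i = 1 \<and> j = 2" if "1 \<le> i" "i < j" "j < 3" for i j :: nat
      using that by linarith
    have *: "P {1..<2} = chi 1" "P {1..<3} = chi 2"
      using assms(2) 1 adj by (subst P_chain; fastforce dest: edge)+
    have "P (insert 0 {1..<3}) = (X + 1) * P {1..<3} - of_int 1 * X * P ({1..<3} - {2})"
    proof (rule P_leaf)
      show "weight 2 0 = 1"
        using assms(3)[of 0 2] 1 by (simp add: mult.commute)
      fix j :: nat assume "j \<in> {1..<3} - {2}"
      then have "j = 1" by auto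
      then show "nonadjacent 0 j"
        using assms(3)[of 0 1] 1 by simp
    qed (use assms(2) 1 in auto)
    moreover have "{1..<3} - {2} = {1..<2::nat}" "insert 0 {1..<3} = {..<Suc 0 + 2::nat}" by auto
    ultimately have "P {..<Suc 0 + 2} = (X + 1) * chi 2 - X * chi 1"
      by (simp only: * of_int_1 mult_1)
    then show ?case
      by (simp add: chi_small algebra_simps power2_eq_square)
  next
    case (ge2 d)
    have "P {..<Suc (Suc (d + 2))} = (X + 1) * P {..<Suc (d + 2)} - of_int 1 * X * P {..<d + 2}"
    proof (rule P_extend)
      show "weight (d + 2) (Suc (d + 2)) = 1"
        using assms(3)[of "d + 2" "Suc (d + 2)"] ge2.prems by simp
      show "nonadjacent j (Suc (d + 2))" if "j < d + 2" for j
        using assms(3)[of j "Suc (d + 2)"] that ge2.prems by simp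
    qed (use ge2.prems assms(2) in simp)
    then show ?case
      using ge2 by (simp add: algebra_simps)
  qed
  from this[of "k - 2"] show ?thesis
    using assms(1) by (simp add: Suc_diff_Suc numeral_2_eq_2)
qed

text \<open>
  Types \<open>B\<^sub>k\<close> and \<open>C\<^sub>k\<close>, again by the leaf recursion. The closed form covers the single vertex
  \<open>k = 1\<close> but not the empty diagram \<open>k = 0\<close>, so the recursion starts at \<open>k = 1, 2\<close>.
\<close>

lemma P_doubled_end:
  assumes "1 \<le> k" "k \<le> n"
    and "\<And>i j. i < j \<Longrightarrow> j < k \<Longrightarrow>
      if j = Suc i then weight i j = (if i = 0 then 2 else 1) else nonadjacent i j"
  shows "P {..<k} = X ^ k + 1"
proof -
  have "P {..<Suc d} = X ^ Suc d + 1" if "Suc d \<le> k" for d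
    using that
  proof (induction d rule: induct_nat_012)
    case 0
    have "P {0..<1} = X + 1"
      using assms(2) 0 by (subst P_chain) (auto simp: chi_Suc)
    then show ?case by (simp add: lessThan_Suc)
  next
    case 1
    have "P {0..<1} = X + 1"
      using assms(2) 1 by (subst P_chain) (auto simp: chi_Suc)
    moreover have "P {..<Suc (Suc 0)} = (X + 1) * P {..<Suc 0} - of_int 2 * X * P {..<0}"
      using assms(2) assms(3)[of 0 1] 1 by (intro P_extend) auto
    ultimately show ?case
      by (simp add: lessThan_Suc algebra_simps)
  next
    case (ge2 d)
    have "P {..<Suc (Suc (Suc d))} = (X + 1) * P {..<Suc (Suc d)} - of_int 1 * X * P {..<Suc d}"
      using ge2.prems assms(2) assms(3)[of "Suc d" "Suc (Suc d)"] assms(3)[of _ "Suc (Suc d)"]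
      by (intro P_extend) auto
    then show ?case
      using ge2 by (simp add: algebra_simps)
  qed
  from this[of "k - 1"] show ?thesis
    using assms(1) by simp
qed

text \<open>
  Removing the branch point \<open>c\<close> together with the leaf splits the chain in two.
\<close>

lemma P_chain_with_leaf:
  assumes "insert v {a..<b} \<subseteq> {..<n}" "v \<notin> {a..<b}" "a \<le> c" "c < b"
    and chain: "\<And>i j. a \<le> i \<Longrightarrow> i < j \<Longrightarrow> j < b \<Longrightarrow>
      if j = Suc i then weight i j = 1 else nonadjacent i j"
    and leaf: "weight c v = 1" "\<And>j. j \<in> {a..<b} - {c} \<Longrightarrow> nonadjacent v j"
  shows "P (insert v {a..<b}) = (X + 1) * chi (b - a) - X * chi (c - a) * chi (b - Suc c)"
proof -
  have "b - 1 \<in> {a..<b}"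
    using assms(3,4) by auto
  then have "b - 1 < n"
    using assms(1) by blast
  then have "b \<le> n" by linarith
  have "P (insert v {a..<b}) = (X + 1) * P {a..<b} - of_int 1 * X * P ({a..<b} - {c})"
    using assms(1-4) leaf by (intro P_leaf) auto
  also have "P {a..<b} = chi (b - a)"
    using \<open>b \<le> n\<close> assms(3,4) by (intro P_chain chain) auto
  also have "{a..<b} - {c} = {a..<c} \<union> {Suc c..<b}"
    using assms(3,4) by auto
  also have "P \<dots> = P {a..<c} * chi (b - Suc c)"
  proof (rule P_disjoint_chain)
    show "nonadjacent i j" if "i \<in> {a..<c}" "j \<in> {Suc c..<b}" for i j
      using chain[of i j] that assms(3,4) by auto
    show "if j = Suc i then weight i j = 1 else nonadjacent i j"
      if "Suc c \<le> i" "i < j" "j < b" for i j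
      using chain[of i j] that assms(3,4) by simp
  qed (use assms(3,4) \<open>b \<le> n\<close> in auto)
  also have "P {a..<c} = chi (c - a)"
    using \<open>b \<le> n\<close> assms(3,4) by (intro P_chain chain) auto
  finally show ?thesis by (simp add: algebra_simps)
qed

text \<open>
  One step of the leaf recursion from type \<open>D\<^sub>N\<close>, along an edge of weight \<open>2\<close>.
\<close>

lemma P_fork_double_edge:
  assumes N: "n = Suc N" "3 \<le> N"
    and weights: "\<And>i j. i < j \<Longrightarrow> j \<le> N \<Longrightarrow>
      if i = N - 1 \<and> j = N then weight i j = 2
      else if i = 0 \<and> j = 2 \<or> 0 < i \<and> j = Suc i then weight i j = 1 else nonadjacent i j"
  shows "P {..<n} = (X - 1)\<^sup>2 * (chi 1 * chi (N - 2))"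
proof -
  obtain d where d: "N = d + 3"
    using N(2) by (metis add.commute le_Suc_ex)
  have fork: "P {..<k} = (X + 1) * (X ^ (k - 1) + 1)" if "2 \<le> k" "k \<le> N" for k
  proof (rule P_fork)
    show "if i = 0 \<and> j = 2 \<or> 0 < i \<and> j = Suc i then weight i j = 1 else nonadjacent i j"
      if "i < j" "j < k" for i j
      using weights[of i j] that \<open>k \<le> N\<close> by simp
  qed (use that N in auto)
  have "P {..<Suc (Suc (d + 2))} =
      (X + 1) * P {..<Suc (d + 2)} - of_int 2 * X * P {..<d + 2}"
  proof (rule P_extend)
    show "weight (d + 2) (Suc (d + 2)) = 2"
      using weights[of "d + 2" "d + 3"] by (simp add: d numeral_3_eq_3)
    show "nonadjacent j (Suc (d + 2))" if "j < d + 2" for j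
      using weights[of j "d + 3"] that by (simp add: d numeral_3_eq_3)
  qed (simp add: N d)
  then have "P {..<n} = (X + 1) * ((X + 1) * (X ^ (d + 2) + 1)) - 2 * X * ((X + 1) * (X ^ (d + 1) + 1))"
    using fork[of "Suc (d + 2)"] fork[of "d + 2"] by (simp add: N d numeral_3_eq_3)
  also have "\<dots> = (X - 1) * (X + 1) * (X ^ Suc (d + 1) - 1)"
    by (simp add: algebra_simps)
  also have "\<dots> = (X - 1)\<^sup>2 * (chi 1 * chi (d + 1))"
    unfolding chi_times[symmetric] by (simp add: chi_Suc power2_eq_square algebra_simps)
  finally show ?thesis by (simp add: d)
qed

text \<open>
  One step of the leaf recursion from type \<open>B\<^sub>N\<close> or \<open>C\<^sub>N\<close>, along an edge of weight \<open>2\<close>.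
\<close>

lemma P_both_ends_doubled:
  assumes N: "n = Suc N" "2 \<le> N"
    and weights: "\<And>i j. i < j \<Longrightarrow> j \<le> N \<Longrightarrow>
      if j = Suc i then weight i j = (if i = 0 \<or> j = N then 2 else 1) else nonadjacent i j"
  shows "P {..<n} = (X - 1)\<^sup>2 * chi (N - 1)"
proof -
  obtain d where d: "N = d + 2"
    using N(2) by (metis add.commute le_Suc_ex)
  have path: "P {..<k} = X ^ k + 1" if "1 \<le> k" "k \<le> N" for k
  proof (rule P_doubled_end)
    show "if j = Suc i then weight i j = (if i = 0 then 2 else 1) else nonadjacent i j"
      if "i < j" "j < k" for i j
      using weights[of i j] that \<open>k \<le> N\<close> by (auto split: if_splits)
  qed (use that N in auto)
  have "P {..<Suc (Suc (d + 1))} =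
      (X + 1) * P {..<Suc (d + 1)} - of_int 2 * X * P {..<d + 1}"
  proof (rule P_extend)
    show "weight (d + 1) (Suc (d + 1)) = 2"
      using weights[of "d + 1" "d + 2"] by (simp add: d)
    show "nonadjacent j (Suc (d + 1))" if "j < d + 1" for j
      using weights[of j "d + 2"] that by (simp add: d)
  qed (simp add: N d)
  then have "P {..<n} = (X + 1) * (X ^ (d + 2) + 1) - 2 * X * (X ^ (d + 1) + 1)"
    using path[of "Suc (d + 1)"] path[of "d + 1"] by (simp add: N d)
  also have "\<dots> = (X - 1) * (X ^ Suc (d + 1) - 1)"
    by (simp add: algebra_simps)
  also have "\<dots> = (X - 1)\<^sup>2 * chi (d + 1)"
    unfolding chi_times[symmetric] by (simp add: power2_eq_square algebra_simps)
  finally show ?thesis by (simp add: d)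
qed

text \<open>
  The new leaf \<open>N\<close> is attached to \<open>N - 2\<close>. Removing both vertices isolates \<open>N - 1\<close>, which
  contributes the factor \<open>X + 1\<close>.
\<close>

lemma P_two_forks:
  assumes N: "n = Suc N" "4 \<le> N"
    and weights: "\<And>i j. i < j \<Longrightarrow> j \<le> N \<Longrightarrow>
      if i = 0 \<and> j = 2 \<or> i = N - 2 \<and> j = N \<or> 0 < i \<and> j = Suc i \<and> j < N
      then weight i j = 1 else nonadjacent i j"
  shows "P {..<n} = (X - 1)\<^sup>2 * (chi 1 * (chi 1 * chi (N - 3)))"
proof -
  obtain d where d: "N = d + 4"
    using N(2) by (metis add.commute le_Suc_ex)
  have fork: "P {..<k} = (X + 1) * (X ^ (k - 1) + 1)" if "2 \<le> k" "k \<le> N" for k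
  proof (rule P_fork)
    show "if i = 0 \<and> j = 2 \<or> 0 < i \<and> j = Suc i then weight i j = 1 else nonadjacent i j"
      if "i < j" "j < k" for i j
      using weights[of i j] that \<open>k \<le> N\<close> by (auto split: if_splits)
  qed (use that N in auto)
  have "P (insert N {..<N}) = (X + 1) * P {..<N} - of_int 1 * X * P ({..<N} - {d + 2})"
  proof (rule P_leaf)
    show "weight (d + 2) N = 1"
      using weights[of "d + 2" N] by (simp add: d)
    show "nonadjacent N j" if "j \<in> {..<N} - {d + 2}" for j
      using weights[of j N] that by (auto simp: d)
  qed (auto simp: N d)
  also have "{..<N} - {d + 2} = insert (d + 3) {..<d + 2}"
    by (auto simp: d)
  also have "P \<dots> = (X + 1) * P {..<d + 2}"
  proof (rule P_isolated)
    show "nonadjacent (d + 3) j" if "j \<in> {..<d + 2}" for j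
      using weights[of j "d + 3"] that by (auto simp: d)
  qed (auto simp: N d)
  also have "insert N {..<N} = {..<n}"
    by (auto simp: N)
  finally have "P {..<n} = (X + 1) * ((X + 1) * (X ^ (d + 3) + 1)) -
      X * ((X + 1) * ((X + 1) * (X ^ (d + 1) + 1)))"
    using fork[of N] fork[of "d + 2"] by (simp add: d add.commute)
  also have "\<dots> = (X + 1) * (X + 1) * (X - 1) * (X ^ Suc (d + 1) - 1)"
    by (simp add: algebra_simps eval_nat_numeral)
  also have "\<dots> = (X - 1)\<^sup>2 * (chi 1 * (chi 1 * chi (d + 1)))"
    unfolding chi_times[symmetric] by (simp add: chi_Suc power2_eq_square algebra_simps)
  finally show ?thesis by (simp add: d)
qed

end

section \<open>Coxeter polynomials of the extended Dynkin diagrams\<close>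

text \<open>
  Reduces a statement about an arbitrary Coxeter transformation to a computation with the leaf
  recursion.
\<close>

lemma char_poly_coxeter_transformation:
  assumes "is_coxeter_transformation (cartan_mat n es) C" "\<forall>(i, j, a, b)\<in>set es. i \<noteq> j"
    and "\<And>w. ordered_diagram n es w \<Longrightarrow> ordered_diagram.P n es w {..<n} = p"
  shows "char_poly C = p"
proof -
  obtain w where w: "distinct w" "set w = {..<n}" "C = reflection_product (cartan_mat n es) w"
    using assms(1) by (auto simp: is_coxeter_transformation_def cartan_mat_def)
  then interpret ordered_diagram n es w
    using assms(2) by unfold_locales
  show ?thesis
    using char_poly_eq assms(3)[OF ordered_diagram_axioms] w(3) by simp
qed

lemma chain_loopless [simp]: "\<forall>(i, j, a, b)\<in>set (chain k l). i \<noteq> j"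
  by (auto simp: chain_def)

lemma chain_loopless' [simp]: "(i, i, a, b) \<notin> set (chain k l)"
  by (auto simp: chain_def)

lemma char_poly_coxeter_A:
  assumes "is_coxeter_transformation (cartan_A n) B" "1 \<le> n"
  shows "char_poly B = chi n"
proof (rule char_poly_coxeter_transformation[OF assms(1)[unfolded cartan_A_def]])
  fix w assume "ordered_diagram n (chain 0 (n - 1)) w"
  then interpret ordered_diagram n "chain 0 (n - 1)" w .
  have "P {0..<n} = chi (n - 0)"
    by (rule P_chain) (use assms(2) in \<open>auto simp: cartan_entry_simps\<close>)
  then show "P {..<n} = chi n"
    by (simp add: atLeast0LessThan)
qed simp

text \<open>
  The branch point is \<open>3\<close>. Vertex \<open>0\<close> is removed first, so that \<open>6\<close> becomes a leaf attached to
  the chain \<open>1, \<dots>, 5\<close>.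
\<close>

lemma char_poly_coxeter_E6:
  assumes "is_coxeter_transformation (ext_cartan tE6) C"
  shows "char_poly C = (X - 1)\<^sup>2 * (chi 1 * (chi 2 * chi 2))"
proof (rule char_poly_coxeter_transformation[OF assms[unfolded ext_cartan.simps]])
  let ?es = "chain 1 5 @ [plain 3 6, plain 6 0]"
  fix w assume "ordered_diagram 7 ?es w"
  then interpret ordered_diagram 7 ?es w .
  have "P (insert 0 (insert 6 {1..<6})) = (X + 1) * P (insert 6 {1..<6})
      - of_int 1 * X * P (insert 6 {1..<6} - {6})"
    by (rule P_leaf) (auto simp: cartan_entry_simps)
  moreover have "P (insert 6 {1..<6}) = (X + 1) * chi (6 - 1) - X * chi (3 - 1) * chi (6 - Suc 3)"
    by (rule P_chain_with_leaf) (auto simp: cartan_entry_simps)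
  moreover have "P {1..<6} = chi (6 - 1)"
    by (rule P_chain) (auto simp: cartan_entry_simps)
  moreover have "insert 0 (insert 6 {1..<6}) = {..<7::nat}" "insert 6 {1..<6} - {6} = {1..<6::nat}"
    by auto
  ultimately have "P {..<7} = (X + 1) * ((X + 1) * chi 5 - X * chi 2 * chi 2) - X * chi 5"
    by simp
  also have "\<dots> = (X - 1)\<^sup>2 * (chi 1 * (chi 2 * chi 2))"
    unfolding chi_small by (simp add: eval_nat_numeral algebra_simps)
  finally show "P {..<7} = (X - 1)\<^sup>2 * (chi 1 * (chi 2 * chi 2))" .
qed simp

lemma char_poly_coxeter_E7:
  assumes "is_coxeter_transformation (ext_cartan tE7) C"
  shows "char_poly C = (X - 1)\<^sup>2 * (chi 1 * (chi 2 * chi 3))"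
proof (rule char_poly_coxeter_transformation[OF assms[unfolded ext_cartan.simps]])
  let ?es = "chain 0 6 @ [plain 3 7]"
  fix w assume "ordered_diagram 8 ?es w"
  then interpret ordered_diagram 8 ?es w .
  have "P (insert 7 {0..<7}) = (X + 1) * chi (7 - 0) - X * chi (3 - 0) * chi (7 - Suc 3)"
    by (rule P_chain_with_leaf) (auto simp: cartan_entry_simps)
  moreover have "insert 7 {0..<7} = {..<8::nat}" by auto
  ultimately have "P {..<8} = (X + 1) * chi 7 - X * chi 3 * chi 3"
    by simp
  also have "\<dots> = (X - 1)\<^sup>2 * (chi 1 * (chi 2 * chi 3))"
    unfolding chi_small by (simp add: eval_nat_numeral algebra_simps)
  finally show "P {..<8} = (X - 1)\<^sup>2 * (chi 1 * (chi 2 * chi 3))" .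
qed simp

lemma char_poly_coxeter_E8:
  assumes "is_coxeter_transformation (ext_cartan tE8) C"
  shows "char_poly C = (X - 1)\<^sup>2 * (chi 1 * (chi 2 * chi 4))"
proof (rule char_poly_coxeter_transformation[OF assms[unfolded ext_cartan.simps]])
  let ?es = "chain 0 7 @ [plain 5 8]"
  fix w assume "ordered_diagram 9 ?es w"
  then interpret ordered_diagram 9 ?es w .
  have "P (insert 8 {0..<8}) = (X + 1) * chi (8 - 0) - X * chi (5 - 0) * chi (8 - Suc 5)"
    by (rule P_chain_with_leaf) (auto simp: cartan_entry_simps)
  moreover have "insert 8 {0..<8} = {..<9::nat}" by auto
  ultimately have "P {..<9} = (X + 1) * chi 8 - X * chi 5 * chi 2"
    by simp
  also have "\<dots> = (X - 1)\<^sup>2 * (chi 1 * (chi 2 * chi 4))"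
    unfolding chi_small by (simp add: eval_nat_numeral algebra_simps)
  finally show "P {..<9} = (X - 1)\<^sup>2 * (chi 1 * (chi 2 * chi 4))" .
qed simp

lemma char_poly_coxeter_D:
  assumes "is_coxeter_transformation (ext_cartan (tD N)) C" "4 \<le> N"
  shows "char_poly C = (X - 1)\<^sup>2 * (chi 1 * (chi 1 * chi (N - 3)))"
proof (rule char_poly_coxeter_transformation[OF assms(1)[unfolded ext_cartan.simps]])
  fix w assume "ordered_diagram (N + 1) (plain 0 2 # chain 1 (N - 1) @ [plain (N - 2) N]) w"
  then interpret ordered_diagram "N + 1" "plain 0 2 # chain 1 (N - 1) @ [plain (N - 2) N]" w .
  show "P {..<N + 1} = (X - 1)\<^sup>2 * (chi 1 * (chi 1 * chi (N - 3)))"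
  proof (rule P_two_forks)
    obtain d where d: "N = d + 4"
      using assms(2) by (metis add.commute le_Suc_ex)
    fix i j assume "i < j" "j \<le> N"
    then show "if i = 0 \<and> j = 2 \<or> i = N - 2 \<and> j = N \<or> 0 < i \<and> j = Suc i \<and> j < N
      then weight i j = 1 else nonadjacent i j"
      by (auto simp: cartan_entry_simps d min_def max_def)
  qed (use assms(2) in simp_all)
qed (use assms(2) in auto)

text \<open>
  The two orientations of the arrow give two diagrams with the same polynomial; the hypothesis
  \<open>a * b = 2\<close> treats them together.
\<close>

lemma char_poly_coxeter_fork_double_edge:
  assumes "is_coxeter_transformation
      (cartan_mat (N + 1) (plain 0 2 # chain 1 (N - 1) @ [(N - 1, N, a, b)])) C"
    and "a * b = 2" "3 \<le> N"
  shows "char_poly C = (X - 1)\<^sup>2 * (chi 1 * chi (N - 2))"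
proof (rule char_poly_coxeter_transformation[OF assms(1)])
  let ?es = "plain 0 2 # chain 1 (N - 1) @ [(N - 1, N, a, b)]"
  fix w assume "ordered_diagram (N + 1) ?es w"
  then interpret ordered_diagram "N + 1" ?es w .
  show "P {..<N + 1} = (X - 1)\<^sup>2 * (chi 1 * chi (N - 2))"
    by (rule P_fork_double_edge) (use assms(2,3) in \<open>auto simp: cartan_entry_simps\<close>)
qed (use assms(3) in auto)

lemma char_poly_coxeter_double_ends:
  assumes "is_coxeter_transformation
      (cartan_mat (N + 1) ((0, 1, c, d) # chain 1 (N - 1) @ [(N - 1, N, a, b)])) C"
    and "a * b = 2" "c * d = 2" "2 \<le> N"
  shows "char_poly C = (X - 1)\<^sup>2 * chi (N - 1)"
proof (rule char_poly_coxeter_transformation[OF assms(1)])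
  let ?es = "(0, 1, c, d) # chain 1 (N - 1) @ [(N - 1, N, a, b)]"
  fix w assume "ordered_diagram (N + 1) ?es w"
  then interpret ordered_diagram "N + 1" ?es w .
  show "P {..<N + 1} = (X - 1)\<^sup>2 * chi (N - 1)"
    by (rule P_both_ends_doubled) (use assms(2-4) in \<open>auto simp: cartan_entry_simps\<close>)
qed (use assms(4) in auto)

lemma char_poly_coxeter_F:
  assumes "is_coxeter_transformation (cartan_mat 5 (chain 0 2 @ [(2, 3, a, b)] @ chain 3 4)) C"
    and "a * b = 2"
  shows "char_poly C = (X - 1)\<^sup>2 * (chi 1 * chi 2)"
proof (rule char_poly_coxeter_transformation[OF assms(1)])
  let ?es = "chain 0 2 @ [(2, 3, a, b)] @ chain 3 4"
  fix w assume "ordered_diagram 5 ?es w"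
  then interpret ordered_diagram 5 ?es w .
  have chain: "P {..<k} = chi k" if "k \<le> 3" for k
    using P_chain[of k 0] that by (auto simp: atLeast0LessThan cartan_entry_simps)
  have "P {..<Suc (Suc 2)} = (X + 1) * P {..<Suc 2} - of_int 2 * X * P {..<2}"
    by (rule P_extend) (use assms(2) in \<open>auto simp: cartan_entry_simps\<close>)
  then have "P {..<4} = (X + 1) * chi 3 - 2 * X * chi 2"
    using chain[of 2] chain[of 3] by simp
  moreover have "P {..<Suc (Suc 3)} = (X + 1) * P {..<Suc 3} - of_int 1 * X * P {..<3}"
    by (rule P_extend) (auto simp: cartan_entry_simps)
  then have "P {..<5} = (X + 1) * P {..<4} - X * chi 3"
    using chain[of 3] by simp
  ultimately have "P {..<5} = (X + 1) * ((X + 1) * chi 3 - 2 * X * chi 2) - X * chi 3"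
    by simp
  also have "\<dots> = (X - 1)\<^sup>2 * (chi 1 * chi 2)"
    unfolding chi_small by (simp add: eval_nat_numeral algebra_simps)
  finally show "P {..<5} = (X - 1)\<^sup>2 * (chi 1 * chi 2)" .
qed auto

lemma char_poly_coxeter_G:
  assumes "is_coxeter_transformation (cartan_mat 3 [plain 0 1, (1, 2, a, b)]) C" "a * b = 3"
  shows "char_poly C = (X - 1)\<^sup>2 * chi 1"
proof (rule char_poly_coxeter_transformation[OF assms(1)])
  fix w assume "ordered_diagram 3 [plain 0 1, (1, 2, a, b)] w"
  then interpret ordered_diagram 3 "[plain 0 1, (1, 2, a, b)]" w .
  have chain: "P {..<k} = chi k" if "k \<le> 2" for k
    using P_chain[of k 0] that by (auto simp: atLeast0LessThan)
  have "P {..<Suc (Suc 1)} = (X + 1) * P {..<Suc 1} - of_int 3 * X * P {..<1}"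
    by (rule P_extend) (use assms(2) in auto)
  then have "P {..<3} = (X + 1) * chi 2 - 3 * X * chi 1"
    using chain[of 1] chain[of 2] by (simp add: eval_nat_numeral)
  also have "\<dots> = (X - 1)\<^sup>2 * chi 1"
    unfolding chi_small by (simp add: eval_nat_numeral algebra_simps)
  finally show "P {..<3} = (X - 1)\<^sup>2 * chi 1" .
qed auto

lemma char_poly_coxeter_two_vertices:
  assumes "is_coxeter_transformation (cartan_mat 2 [(0, 1, a, b)]) C" "a * b = 4"
  shows "char_poly C = (X - 1)\<^sup>2"
proof (rule char_poly_coxeter_transformation[OF assms(1)])
  fix w assume "ordered_diagram 2 [(0, 1, a, b)] w"
  then interpret ordered_diagram 2 "[(0, 1, a, b)]" w .
  have "P {0..<1} = chi (1 - 0)"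
    by (rule P_chain) auto
  then have "P {..<Suc 0} = X + 1"
    by (simp add: lessThan_Suc chi_Suc)
  moreover have "P {..<Suc (Suc 0)} = (X + 1) * P {..<Suc 0} - of_int 4 * X * P {..<0}"
    by (rule P_extend) (use assms(2) in auto)
  moreover have "{..<Suc (Suc 0)} = {..<2}" by auto
  ultimately have "P {..<2} = (X + 1) * (X + 1) - 4 * X"
    by (simp only: lessThan_0 P_empty of_int_numeral mult_1_right)
  then show "P {..<2} = (X - 1)\<^sup>2"
    by (simp add: power2_eq_square algebra_simps)
qed auto

lemma char_poly_affine_coxeter:
  assumes "is_ext_dynkin G" "is_coxeter_transformation (ext_cartan G) C"
  shows "char_poly C = (X - 1)\<^sup>2 * (\<Prod>p\<leftarrow>branch_lengths G. chi (p - 1))"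
proof (cases G)
  case tE6
  then show ?thesis using char_poly_coxeter_E6 assms(2) by simp
next
  case tE7
  then show ?thesis using char_poly_coxeter_E7 assms(2) by simp
next
  case tE8
  then show ?thesis using char_poly_coxeter_E8 assms(2) by simp
next
  case (tD N)
  then show ?thesis using char_poly_coxeter_D assms by simp
next
  case tF41
  then show ?thesis using char_poly_coxeter_F[of "-2" "-1"] assms(2) by simp
next
  case tF42
  then show ?thesis using char_poly_coxeter_F[of "-1" "-2"] assms(2) by simp
next
  case (tCD N)
  then show ?thesis
    using char_poly_coxeter_fork_double_edge[of N "-1" "-2"] assms by (simp add: numeral_2_eq_2)
next
  case (tDD N)
  then show ?thesis
    using char_poly_coxeter_fork_double_edge[of N "-2" "-1"] assms by (simp add: numeral_2_eq_2)
next
  case tG21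
  then show ?thesis using char_poly_coxeter_G[of "-3" "-1"] assms(2) by simp
next
  case tG22
  then show ?thesis using char_poly_coxeter_G[of "-1" "-3"] assms(2) by simp
next
  case (tB N)
  then show ?thesis using char_poly_coxeter_double_ends[of N "-2" "-1" "-1" "-2"] assms by simp
next
  case (tC N)
  then show ?thesis using char_poly_coxeter_double_ends[of N "-1" "-2" "-2" "-1"] assms by simp
next
  case (tBC N)
  then show ?thesis using char_poly_coxeter_double_ends[of N "-2" "-1" "-2" "-1"] assms by simp
next
  case tA11
  then show ?thesis using char_poly_coxeter_two_vertices[of "-4" "-1"] assms(2) by simp
next
  case tA12
  then show ?thesis using char_poly_coxeter_two_vertices[of "-2" "-2"] assms(2) by simp
qed

section \<open>Comparison with the branches\<close>

lemma char_poly_four_block_diag: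
  fixes A D :: "'a :: idom mat"
  assumes A: "A \<in> carrier_mat a a" and D: "D \<in> carrier_mat d d"
  shows "char_poly (four_block_mat A (0\<^sub>m a d) (0\<^sub>m d a) D) = char_poly A * char_poly D"
proof -
  have dims: "dim_row A = a" "dim_col A = a" "dim_row D = d" "dim_col D = d"
    using A D by auto
  have "char_poly_matrix (four_block_mat A (0\<^sub>m a d) (0\<^sub>m d a) D) =
    four_block_mat (char_poly_matrix A) (0\<^sub>m a d) (0\<^sub>m d a) (char_poly_matrix D)"
    by (rule eq_matI) (auto simp: char_poly_matrix_def dims one_mat_def)
  then show ?thesis
    unfolding char_poly_def
    using det_four_block_mat_upper_right_zero[OF char_poly_matrix_closed[OF A] refl _
      char_poly_matrix_closed[OF D]] by simp
qed

lemma char_poly_diag_block_mat: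
  fixes Bs :: "'a :: idom mat list"
  assumes "\<And>B. B \<in> set Bs \<Longrightarrow> square_mat B"
  shows "char_poly (diag_block_mat Bs) = prod_list (map char_poly Bs)"
  using assms
proof (induction Bs)
  case Nil
  then show ?case by (simp add: char_poly_def char_poly_matrix_def det_dim_zero)
next
  case (Cons B Bs)
  let ?D = "diag_block_mat Bs"
  have dims: "dim_col B = dim_row B" "dim_col ?D = dim_row ?D"
    using Cons.prems[of B] diag_block_mat_square[of Bs] Cons.prems by auto
  have "char_poly (diag_block_mat (B # Bs)) = char_poly B * char_poly ?D"
    unfolding diag_block_mat.simps Let_def dims
    by (rule char_poly_four_block_diag) (auto intro: carrier_matI simp: dims)
  moreover have "char_poly ?D = prod_list (map char_poly Bs)"
    using Cons.prems by (intro Cons.IH) auto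
  ultimately show ?case
    by (simp only: list.map prod_list.Cons)
qed

theorem theorem1p2:
  fixes G :: ext_dynkin and g :: nat and C :: "complex mat" and Bs :: "complex mat list"
  assumes "is_ext_dynkin G"
    and "ext_class G = g"
    and "is_coxeter_transformation (ext_cartan G) C"
    and "list_all2 (\<lambda>p B. is_coxeter_transformation (cartan_A (p - 1)) B) (branch_lengths G) Bs"
  shows "length Bs = 3 - g \<and>
     eigenvalue_mset C = eigenvalue_mset (diag_block_mat Bs) + {#1, 1#} \<and>
     (g = 0 \<longrightarrow> (\<exists>p q r. branch_lengths G = [p, q, r] \<and>
        char_poly C = [:-1, 1:]\<^sup>2 * chi (p - 1) * chi (q - 1) * chi (r - 1))) \<and>
     (g = 1 \<longrightarrow> (\<exists>p q. branch_lengths G = [p, q] \<and>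
        char_poly C = [:-1, 1:]\<^sup>2 * chi (p - 1) * chi (q - 1))) \<and>
     (g = 2 \<longrightarrow> (\<exists>p. branch_lengths G = [p] \<and>
        char_poly C = [:-1, 1:]\<^sup>2 * chi (p - 1))) \<and>
     (g = 3 \<longrightarrow> char_poly C = [:-1, 1:]\<^sup>2)"
proof -
  have "X - 1 = [:-1, 1:]"
    by (simp add: X_def one_pCons)
  then have C: "char_poly C = [:-1, 1:]\<^sup>2 * (\<Prod>p\<leftarrow>branch_lengths G. chi (p - 1))"
    using char_poly_affine_coxeter[OF assms(1,3)] by simp
  have len: "length (branch_lengths G) = 3 - g"
    using assms(2) by (cases G) auto
  \<comment> \<open>So no branch is empty, and the characteristic polynomial of type A applies to each of them.\<close>
  have branch: "2 \<le> p" if "p \<in> set (branch_lengths G)" for p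
    using that assms(1) by (cases G) auto
  have blocks: "map char_poly Bs = map (\<lambda>p. chi (p - 1)) (branch_lengths G)"
    using assms(4) branch
  proof (induction rule: list_all2_induct)
    case (Cons p ps B Bs)
    from Cons.prems have "2 \<le> p" by simp
    then have "1 \<le> p - 1" by linarith
    with Cons show ?case
      using char_poly_coxeter_A[of "p - 1" B] by simp
  qed simp
  have "square_mat B" if "B \<in> set Bs" for B
    using that assms(4)
    by (auto simp: list_all2_conv_all_nth in_set_conv_nth is_coxeter_transformation_def
        reflection_product_def mat_of_cols_def)
  then have D: "char_poly (diag_block_mat Bs) = (\<Prod>p\<leftarrow>branch_lengths G. chi (p - 1))"
    by (simp add: char_poly_diag_block_mat blocks)
  have "chi m \<noteq> 0" for m
  proof -
    have "poly (chi m) 0 = 1"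
      by (cases m) (simp_all add: chi_Suc X_def)
    then show ?thesis by auto
  qed
  then have "char_poly (diag_block_mat Bs) \<noteq> 0"
    unfolding D by (auto simp: prod_list_zero_iff)
  moreover have "[:-1, 1:]\<^sup>2 \<noteq> (0 :: complex poly)"
    by simp
  ultimately have factors: "proots ([:-1, 1:]\<^sup>2 * char_poly (diag_block_mat Bs)) =
      proots ([:-1, 1:]\<^sup>2) + proots (char_poly (diag_block_mat Bs))"
    by (intro proots_mult)
  have roots: "proots ([:-1, 1:]\<^sup>2 :: complex poly) = {#1, 1#}"
    unfolding proots_power by (simp add: numeral_2_eq_2)
  have "eigenvalue_mset C = eigenvalue_mset (diag_block_mat Bs) + {#1, 1#}"
    unfolding eigenvalue_mset_def C D[symmetric] factors roots
    by (rule add.commute)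
  moreover have "length Bs = 3 - g"
    using len assms(4) by (simp add: list_all2_lengthD)
  moreover define Q :: "complex poly" where "Q = [:-1, 1:]\<^sup>2"
  ultimately show ?thesis
    using C unfolding Q_def[symmetric] assms(2)[symmetric] by (cases G) (simp_all add: mult.assoc)
qed

end
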